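(* Let $\rho=(i_1,i_2,\ldots,i_l)$ be a reduced decomposition of the long word $w_0=n,n-1,\ldots,1$ in $S_n$, where $l=\binom n2$. Let $$X=\{(1,2,3,2,1,2),\ (3,2,1,2,3,2),\ (2,1,2,3,2,1),\ (2,3,2,1,2,3)\}.$$ Then the number of $X$-subnetworks induced by $\rho$ is equal to $$\sum_{j=1}^{l}(i_j-1)(n-i_j-1)-2\binom n4 .$$
   Context: A reduced decomposition of $w\in S_n$ is a sequence $(i_1,\ldots,i_l)$ with entries in $\{1,\ldots,n-1\}$, where $l$ is the number of inversions of $w$, such that $w=s_{i_1}s_{i_2}\cdots s_{i_l}$, where $s_i$ is the adjacent transposition swapping the entries in positions $i$ and $i+1$ (so $w$ is obtained from $12\cdots n$ by successively swapping the entries in positions $i_k,i_k+1$). Subnetworks: let $\rho=(i_1,\ldots,i_l)$ be a reduced decomposition of $w\in S_n$ and let $A\subseteq\{1,\ldots,n\}$ be a set of $m$ distinct integers. Follow the sequence of words from $12\cdots n$ to $w$ determined by $\rho$, keeping track only of the relative positions of the elements of $A$. Whenever a step of $\rho$ swaps two elements of $A$, these two occupy positions $j$ and $j+1$ among the elements of $A$ (for some $1\le j\le m-1$); record $j$. The resulting sequence of recorded indices is the reduced decomposition of $A$ induced by $\rho$ (a reduced decomposition of the permutation in $S_m$ with the same relative order as the elements of $A$ in $w$). If $X$ is a set of reduced decompositions of an element of $S_m$, an $X$-subnetwork of $\rho$ is a set $A$ of $m$ distinct integers of $\{1,\ldots,n\}$ whose reduced decomposition induced by $\rho$ belongs to $X$.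 (In the claim, $m=4$ and all elements of $X$ are reduced decompositions of $4321$.) *)

theory Defs
  imports "HOL-Combinatorics.Transposition"
begin

text \<open>
  A permutation of \<open>{1..n}\<close> is a function on \<open>nat\<close> that is the identity outside \<open>{1..n}\<close>; it is
  read as the word \<open>w 1, w 2, \<dots>, w n\<close>. Composing with \<open>transpose i (Suc i)\<close> on the right thus
  swaps the entries in the positions \<open>i\<close> and \<open>i + 1\<close>.
\<close>

definition swap_positions :: "(nat \<Rightarrow> nat) \<Rightarrow> nat \<Rightarrow> (nat \<Rightarrow> nat)" where
  "swap_positions w i = w \<circ> transpose i (Suc i)"

definition word_product :: "nat list \<Rightarrow> (nat \<Rightarrow> nat)" where
  "word_product \<rho> = foldl swap_positions id \<rho>"

definition inversions :: "nat \<Rightarrow> (nat \<Rightarrow> nat) \<Rightarrow> (nat \<times> nat) set" where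
  "inversions n w = {(p, q). 1 \<le> p \<and> p < q \<and> q \<le> n \<and> w p > w q}"

definition reduced_decomposition :: "nat \<Rightarrow> (nat \<Rightarrow> nat) \<Rightarrow> nat list \<Rightarrow> bool" where
  "reduced_decomposition n w \<rho> \<longleftrightarrow>
     set \<rho> \<subseteq> {1..<n} \<and> length \<rho> = card (inversions n w) \<and> word_product \<rho> = w"

definition long_word :: "nat \<Rightarrow> (nat \<Rightarrow> nat)" where
  "long_word n = (\<lambda>p. if p \<in> {1..n} then n + 1 - p else p)"

text \<open>
  The indices recorded for the elements of \<open>A\<close> when the steps of a sequence are applied starting
  from the word \<open>w\<close>. If the entries in positions \<open>i\<close> and \<open>i + 1\<close> both belong to \<open>A\<close>, then the
  former is the \<open>j\<close>-th element of \<open>A\<close> in the word, where \<open>j\<close> is the number of positions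
  \<open>p \<le> i\<close> whose entry is in \<open>A\<close>.
\<close>

fun recorded_indices :: "nat set \<Rightarrow> (nat \<Rightarrow> nat) \<Rightarrow> nat list \<Rightarrow> nat list" where
  "recorded_indices A w [] = []"
| "recorded_indices A w (i # \<rho>) =
     (if w i \<in> A \<and> w (Suc i) \<in> A then [card {p \<in> {1..i}. w p \<in> A}] else [])
     @ recorded_indices A (swap_positions w i) \<rho>"

definition induced_decomposition :: "nat set \<Rightarrow> nat list \<Rightarrow> nat list" where
  "induced_decomposition A \<rho> = recorded_indices A id \<rho>"

text \<open>Here \<open>X\<close> is a set of reduced decompositions of an element of \<open>S\<^sub>m\<close>.\<close>

definition subnetworks :: "nat \<Rightarrow> nat \<Rightarrow> nat list set \<Rightarrow> nat list \<Rightarrow> nat set set" where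
  "subnetworks n m X \<rho> = {A. A \<subseteq> {1..n} \<and> card A = m \<and> induced_decomposition A \<rho> \<in> X}"

end

theory Submission
  imports Defs "HOL-Combinatorics.Permutations"
begin

text \<open>
  A step swapping the positions \<open>i\<close> and \<open>i + 1\<close> has \<open>i - 1\<close> entries to its left and
  \<open>n - i - 1\<close> to its right, so \<open>(i - 1) (n - i - 1)\<close> counts the 4-element sets for which this
  step records the index 2. The sum therefore counts the occurrences of 2 in all decompositions
  induced on 4-element sets. As \<open>\<rho>\<close> has as many steps as the long word has inversions, every step
  swaps an ascent, so the induced decompositions are again reduced. Each of
  the 16 reduced decompositions of 4321 contains 2 exactly twice, except for the four members of
  \<open>X\<close>, which contain it three times.
\<close>

section \<open>Inversions\<close>

lemma finite_inversions: "finite (inversions n w)"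
  by (rule finite_subset[of _ "{1..n} \<times> {1..n}"]) (auto simp: inversions_def)

lemma card_pairs_less: "card {(p, q). 1 \<le> p \<and> p < q \<and> q \<le> n} = n choose 2"
proof (induction n)
  case 0
  have "{(p, q). 1 \<le> p \<and> p < q \<and> q \<le> (0::nat)} = {}"
    by auto
  then show ?case by (simp only: card.empty) simp
next
  case (Suc n)
  have "{(p, q). 1 \<le> p \<and> p < q \<and> q \<le> Suc n} =
      {(p, q). 1 \<le> p \<and> p < q \<and> q \<le> n} \<union> {1..n} \<times> {Suc n}"
    by auto
  moreover have "finite {(p, q). 1 \<le> p \<and> p < q \<and> q \<le> n}"
    by (rule finite_subset[of _ "{1..n} \<times> {1..n}"]) auto
  moreover have "{(p, q). 1 \<le> p \<and> p < q \<and> q \<le> n} \<inter> {1..n} \<times> {Suc n} = {}"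
    by auto
  ultimately show ?case
    using Suc by (simp add: card_Un_disjoint numeral_2_eq_2)
qed

lemma card_inversions_long_word: "card (inversions n (long_word n)) = n choose 2"
proof -
  have "inversions n (long_word n) = {(p, q). 1 \<le> p \<and> p < q \<and> q \<le> n}"
    by (auto simp: inversions_def long_word_def)
  then show ?thesis
    by (simp only: card_pairs_less)
qed

text \<open>Applying the transposition to both positions keeps their order for every pair except
  \<open>(i, Suc i)\<close>, so any other inversion after the swap comes from one before it.\<close>

lemma inversions_swap_positions_subset:
  assumes "i \<in> {1..<n}"
  shows "inversions n (swap_positions w i) - {(i, Suc i)} \<subseteq>
    map_prod (transpose i (Suc i)) (transpose i (Suc i)) ` inversions n w"
proof (rule subrelI)
  let ?t = "transpose i (Suc i)"
  fix p q
  assume "(p, q) \<in> inversions n (swap_positions w i) - {(i, Suc i)}"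
  then have "(p, q) \<in> inversions n (swap_positions w i)" and ne: "\<not> (p, q) = (i, Suc i)"
    by auto
  then have pq: "1 \<le> p" "p < q" "q \<le> n" "w (?t p) > w (?t q)"
    by (auto simp: inversions_def swap_positions_def)
  have "1 \<le> ?t p" "?t p < ?t q" "?t q \<le> n"
    using assms pq ne by (auto simp: transpose_def)
  then have "(?t p, ?t q) \<in> inversions n w"
    using pq by (auto simp: inversions_def)
  then have "map_prod ?t ?t (?t p, ?t q) \<in> map_prod ?t ?t ` inversions n w"
    by (rule imageI)
  then show "(p, q) \<in> map_prod ?t ?t ` inversions n w"
    by simp
qed

text \<open>Only the pair \<open>(i, Suc i)\<close> can be gained, and only at an ascent. The
  conditional summand is what later shows that a step gaining an inversion swaps an ascent.\<close>

lemma card_inversions_swap_positions_le: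
  assumes "i \<in> {1..<n}"
  shows "card (inversions n (swap_positions w i)) \<le>
    card (inversions n w) + (if w i < w (Suc i) then 1 else 0)"
proof -
  let ?I = "inversions n (swap_positions w i)"
  have "card (?I - {(i, Suc i)}) \<le> card (inversions n w)"
    using inversions_swap_positions_subset[OF assms] finite_inversions
    by (rule surj_card_le[rotated])
  moreover have "(i, Suc i) \<in> ?I \<Longrightarrow> w i < w (Suc i)"
    by (auto simp: inversions_def swap_positions_def)
  ultimately show ?thesis
    by (cases "(i, Suc i) \<in> ?I") (auto simp: finite_inversions card_Diff_singleton)
qed

lemma card_inversions_foldl_le:
  assumes "set \<rho> \<subseteq> {1..<n}"
  shows "card (inversions n (foldl swap_positions w \<rho>)) \<le> card (inversions n w) + length \<rho>"
  using assms
proof (induction \<rho> arbitrary: w)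
  case Nil
  then show ?case by simp
next
  case (Cons i \<rho>)
  then have "card (inversions n (foldl swap_positions w (i # \<rho>))) \<le>
      card (inversions n (swap_positions w i)) + length \<rho>"
    by simp
  also have "card (inversions n (swap_positions w i)) \<le> card (inversions n w) + 1"
    using card_inversions_swap_positions_le[of i n w] Cons.prems by (auto split: if_splits)
  finally show ?case by simp
qed

section \<open>Restriction of words to a subset\<close>

text \<open>Describes upward paths in the weak order: \<open>js\<close> leads from one word to
  another, each step swapping two adjacent letters in increasing order. The words are plain lists,
  so the ambient positions disappear; \<open>Suc (length us)\<close> is the 1-based position of the
  left letter.\<close>

inductive ascents :: "'a::linorder list \<Rightarrow> nat list \<Rightarrow> 'a list \<Rightarrow> bool" where
  ascents_Nil: "ascents u [] u"
| ascents_Cons: "x < y \<Longrightarrow> ascents (us @ y # x # vs) js v \<Longrightarrow>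
    ascents (us @ x # y # vs) (Suc (length us) # js) v"

definition restricted_word :: "nat \<Rightarrow> nat set \<Rightarrow> (nat \<Rightarrow> nat) \<Rightarrow> nat list" where
  "restricted_word n A w = filter (\<lambda>x. x \<in> A) (map w [1..<Suc n])"

text \<open>Turns the cardinality that defines a recorded index into the length of a prefix of the
  restricted word.\<close>

lemma length_filter_map_upt:
  "length (filter (\<lambda>x. x \<in> A) (map w [1..<m])) = card {p \<in> {1..<m}. w p \<in> A}"
proof -
  have "length (filter (\<lambda>x. x \<in> A) (map w [1..<m])) = card (set (filter (\<lambda>p. w p \<in> A) [1..<m]))"
    by (subst distinct_card) (auto simp: filter_map o_def)
  also have "set (filter (\<lambda>p. w p \<in> A) [1..<m]) = {p \<in> {1..<m}. w p \<in> A}"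
    by auto
  finally show ?thesis .
qed

text \<open>The swap leaves the entries to the left and right of the pair alone; \<open>us\<close>
  and \<open>vs\<close> are what remains of them in \<open>A\<close>. Filtering the pair covers all
  cases of membership at once, and the last fact matches the recorded index with the one in
  \<open>ascents_Cons\<close>.\<close>

lemma restricted_word_split:
  assumes "i \<in> {1..<n}"
  obtains us vs where
    "restricted_word n A w = us @ filter (\<lambda>x. x \<in> A) [w i, w (Suc i)] @ vs"
    "restricted_word n A (swap_positions w i) = us @ filter (\<lambda>x. x \<in> A) [w (Suc i), w i] @ vs"
    "w i \<in> A \<Longrightarrow> card {p \<in> {1..i}. w p \<in> A} = Suc (length us)"
proof -
  let ?F = "\<lambda>w ps. filter (\<lambda>x. x \<in> A) (map w ps)"
  have upt: "[1..<Suc n] = [1..<i] @ [i, Suc i] @ [Suc (Suc i)..<Suc n]"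
  proof -
    have "[1..<Suc n] = [1..<i] @ [i..<Suc n]"
      using assms upt_add_eq_append[of 1 i "Suc n - i"] by auto
    also have "[i..<Suc n] = [i, Suc i] @ [Suc (Suc i)..<Suc n]"
      using assms by (auto simp: upt_conv_Cons)
    finally show ?thesis .
  qed
  have "?F (swap_positions w i) [1..<i] = ?F w [1..<i]"
    by (intro arg_cong[where f = "filter _"] map_cong)
      (auto simp: swap_positions_def transpose_def)
  moreover have "?F (swap_positions w i) [Suc (Suc i)..<Suc n] = ?F w [Suc (Suc i)..<Suc n]"
    by (intro arg_cong[where f = "filter _"] map_cong)
      (auto simp: swap_positions_def transpose_def)
  moreover have "card {p \<in> {1..i}. w p \<in> A} = Suc (length (?F w [1..<i]))" if "w i \<in> A"
  proof -
    have "{p \<in> {1..i}. w p \<in> A} = insert i {p \<in> {1..<i}. w p \<in> A}"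
      using that assms by auto
    then show ?thesis
      by (simp only: length_filter_map_upt) simp
  qed
  moreover have "swap_positions w i i = w (Suc i)" "swap_positions w i (Suc i) = w i"
    by (simp_all add: swap_positions_def)
  ultimately show ?thesis
    by (intro that[of "?F w [1..<i]" "?F w [Suc (Suc i)..<Suc n]"])
      (simp_all only: restricted_word_def upt map_append filter_append list.map)
qed

text \<open>Equality in the length hypothesis means that every step gains an inversion, hence swaps
  an ascent. Such a step is an ascent of the restricted word if both entries lie in
  \<open>A\<close>, and is invisible there otherwise.\<close>

lemma ascents_recorded_indices:
  assumes "set \<rho> \<subseteq> {1..<n}"
    and "card (inversions n (foldl swap_positions w \<rho>)) = card (inversions n w) + length \<rho>"
  shows "ascents (restricted_word n A w) (recorded_indices A w \<rho>)
    (restricted_word n A (foldl swap_positions w \<rho>))"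
  using assms
proof (induction \<rho> arbitrary: w)
  case Nil
  then show ?case by (simp add: ascents_Nil)
next
  case (Cons i \<rho>)
  let ?w = "swap_positions w i"
  have i: "i \<in> {1..<n}" and \<rho>: "set \<rho> \<subseteq> {1..<n}"
    using Cons.prems by auto
  note le = card_inversions_swap_positions_le[OF i, of w] card_inversions_foldl_le[OF \<rho>, of ?w]
  \<comment> \<open>Otherwise this step gains nothing, and the remaining
    \<open>length \<rho>\<close> steps cannot make up for the missing inversion.\<close>
  have less: "w i < w (Suc i)"
    using le Cons.prems(2) by (auto split: if_splits)
  have "card (inversions n (foldl swap_positions ?w \<rho>)) = card (inversions n ?w) + length \<rho>"
    using le Cons.prems(2) less by simp
  then have IH: "ascents (restricted_word n A ?w) (recorded_indices A ?w \<rho>)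
      (restricted_word n A (foldl swap_positions ?w \<rho>))"
    by (rule Cons.IH[OF \<rho>])
  obtain us vs where split:
    "restricted_word n A w = us @ filter (\<lambda>x. x \<in> A) [w i, w (Suc i)] @ vs"
    "restricted_word n A ?w = us @ filter (\<lambda>x. x \<in> A) [w (Suc i), w i] @ vs"
    "w i \<in> A \<Longrightarrow> card {p \<in> {1..i}. w p \<in> A} = Suc (length us)"
    using restricted_word_split[OF i, of A w] by blast
  show ?case
  proof (cases "w i \<in> A \<and> w (Suc i) \<in> A")
    case True
    then show ?thesis
      using IH split less ascents_Cons[of "w i" "w (Suc i)" us vs] by simp
  next
    case False
    \<comment> \<open>At most one letter of the pair survives the filter, so its order is
      immaterial.\<close>
    then have "restricted_word n A ?w = restricted_word n A w"
      using split by auto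
    then show ?thesis
      using IH False by auto
  qed
qed

lemma restricted_word_id:
  assumes "A \<subseteq> {1..n}"
  shows "restricted_word n A id = sorted_list_of_set A"
proof -
  have "set (restricted_word n A id) = A"
    using assms by (auto simp: restricted_word_def)
  moreover have "sorted_wrt (<) (restricted_word n A id)"
    unfolding restricted_word_def by (intro sorted_wrt_filter) (simp del: upt_Suc)
  ultimately show ?thesis
    using sorted_list_of_set.idem_if_sorted_distinct[of "restricted_word n A id"]
    by (simp add: strict_sorted_iff)
qed

lemma restricted_word_long_word:
  "restricted_word n A (long_word n) = rev (restricted_word n A id)"
proof -
  have "map (long_word n) [1..<Suc n] = rev [1..<Suc n]"
    by (rule nth_equalityI) (auto simp: rev_nth long_word_def simp del: upt_Suc)
  then show ?thesis
    by (simp add: restricted_word_def rev_filter del: upt_Suc)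
qed

section \<open>Reduced decompositions of 4321\<close>

lemma ascents_four_cases:
  assumes "ascents [a, b, c, d] js v"
  obtains "js = []" "v = [a, b, c, d]"
    | js' where "js = 1 # js'" "a < b" "ascents [b, a, c, d] js' v"
    | js' where "js = 2 # js'" "b < c" "ascents [a, c, b, d] js' v"
    | js' where "js = 3 # js'" "c < d" "ascents [a, b, d, c] js' v"
  using assms
proof cases
  case ascents_Nil
  then show ?thesis using that by blast
next
  case (ascents_Cons x y us vs js')
  then show ?thesis
    \<comment> \<open>Two letters follow \<open>us\<close> in a word of four, so its length is 0, 1
      or 2.\<close>
    using that by (auto simp: Cons_eq_append_conv)
qed

text \<open>The conditionals keep the simplifier from unfolding past a descent, where it would loop.\<close>

lemma ascents_four_iff:
  "ascents [a, b, c, d] js v \<longleftrightarrow>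
     (js = [] \<and> v = [a, b, c, d]) \<or>
     (if a < b then \<exists>js'. js = 1 # js' \<and> ascents [b, a, c, d] js' v else False) \<or>
     (if b < c then \<exists>js'. js = 2 # js' \<and> ascents [a, c, b, d] js' v else False) \<or>
     (if c < d then \<exists>js'. js = 3 # js' \<and> ascents [a, b, d, c] js' v else False)"
  (is "?l = ?r")
proof
  show "?l \<Longrightarrow> ?r"
    by (erule ascents_four_cases) auto
  have "ascents [a, b, c, d] (1 # js') v" if "a < b" "ascents [b, a, c, d] js' v" for js'
    using ascents_Cons[of a b "[]" "[c, d]"] that by simp
  moreover have "ascents [a, b, c, d] (2 # js') v" if "b < c" "ascents [a, c, b, d] js' v" for js'
    using ascents_Cons[of b c "[a]" "[d]"] that by (simp add: numeral_eq_Suc)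
  moreover have "ascents [a, b, c, d] (3 # js') v" if "c < d" "ascents [a, b, d, c] js' v" for js'
    using ascents_Cons[of c d "[a, b]" "[]"] that by (simp add: numeral_eq_Suc)
  ultimately show "?r \<Longrightarrow> ?l"
    using ascents_Nil[of "[a, b, c, d]"] by (metis (full_types))
qed

lemma count_list_ascents_four:
  assumes "a < b" "b < c" "c < d" and "ascents [a, b, c, d] js [d, c, b, a]"
  shows "count_list js 2 = 2 + (if js \<in>
    {[1,2,3,2,1,2], [3,2,1,2,3,2], [2,1,2,3,2,1], [2,3,2,1,2,3]} then 1 else 0)"
proof -
  have less: "a < b" "a < c" "a < d" "b < c" "b < d" "c < d"
    using assms by auto
  then have not_less: "\<not> b < a" "\<not> c < a" "\<not> d < a" "\<not> c < b" "\<not> d < b" "\<not> d < c"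
    by auto
  \<comment> \<open>While \<open>not_less\<close> closes the branches at descents, these
    inequalities discard paths that stop before the full reversal.\<close>
  have ne: "a \<noteq> b" "a \<noteq> c" "a \<noteq> d" "b \<noteq> c" "b \<noteq> d" "c \<noteq> d"
    using less by auto
  show ?thesis
    using assms(4)
    by (simp add: ascents_four_iff less not_less ne ne[symmetric] del: One_nat_def)
      (elim disjE exE conjE; simp)
qed

section \<open>Counting the occurrences of the index 2\<close>

text \<open>Of the two elements up to \<open>i\<close>, one is \<open>i\<close> itself; of the two
  above, one is \<open>Suc i\<close>. This leaves a free choice of one element on each side.\<close>

lemma card_sets_around:
  assumes "i \<in> {1..<n}"
  shows "card {B. B \<subseteq> {1..n} \<and> card B = 4 \<and> i \<in> B \<and> Suc i \<in> B \<and> card (B \<inter> {1..i}) = 2} =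
    (i - 1) * (n - i - 1)"
proof -
  let ?S = "{B. B \<subseteq> {1..n} \<and> card B = 4 \<and> i \<in> B \<and> Suc i \<in> B \<and> card (B \<inter> {1..i}) = 2}"
  let ?f = "\<lambda>(p, q). {p, i, Suc i, q}"
  have "bij_betw ?f ({1..<i} \<times> {Suc (Suc i)..n}) ?S"
    unfolding bij_betw_def
  proof
    show "inj_on ?f ({1..<i} \<times> {Suc (Suc i)..n})"
    proof (rule inj_onI, clarify)
      fix p q p' q'
      assume "p \<in> {1..<i}" "q \<in> {Suc (Suc i)..n}" "p' \<in> {1..<i}" "q' \<in> {Suc (Suc i)..n}"
        and eq: "{p, i, Suc i, q} = {p', i, Suc i, q'}"
      moreover have "p \<in> {p', i, Suc i, q'}" "q \<in> {p', i, Suc i, q'}"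
        unfolding eq[symmetric] by auto
      ultimately show "p = p' \<and> q = q'"
        by auto
    qed
    show "?f ` ({1..<i} \<times> {Suc (Suc i)..n}) = ?S"
    proof (intro set_eqI iffI)
      fix B assume "B \<in> ?f ` ({1..<i} \<times> {Suc (Suc i)..n})"
      then obtain p q where B: "B = {p, i, Suc i, q}" and p: "1 \<le> p" "p < i"
        and q: "Suc (Suc i) \<le> q" "q \<le> n"
        by auto
      then have "B \<inter> {1..i} = {p, i}"
        by auto
      then show "B \<in> ?S"
        using B p q by auto
    next
      fix B assume B: "B \<in> ?S"
      then have fin: "finite B"
        by (auto intro: finite_subset)
      have "card (B \<inter> {1..i} - {i}) = 1"
        using B assms fin by (subst card_Diff_singleton) auto
      then obtain p where p: "B \<inter> {1..i} - {i} = {p}"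
        by (auto simp: card_1_singleton_iff)
      have "card (B - B \<inter> {1..i}) = 2"
        using B fin by (subst card_Diff_subset) auto
      then have "card (B - B \<inter> {1..i} - {Suc i}) = 1"
        using B fin by (subst card_Diff_singleton) auto
      then obtain q where q: "B - B \<inter> {1..i} - {Suc i} = {q}"
        by (auto simp: card_1_singleton_iff)
      have "B = {p, i, Suc i, q}"
        using p q B by blast
      moreover have "p \<in> {1..<i}"
      proof -
        have "p \<in> B \<inter> {1..i} - {i}"
          unfolding p by simp
        then show ?thesis
          by auto
      qed
      moreover have "q \<in> {Suc (Suc i)..n}"
      proof -
        have "q \<in> B - B \<inter> {1..i} - {Suc i}"
          unfolding q by simp
        moreover have "B \<subseteq> {1..n}"
          using B by simp
        ultimately show ?thesis
          by auto
      qed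
      ultimately show "B \<in> ?f ` ({1..<i} \<times> {Suc (Suc i)..n})"
        by (intro image_eqI[of _ _ "(p, q)"]) auto
    qed
  qed
  from bij_betw_same_card[OF this] show ?thesis
    by (simp add: card_cartesian_product)
qed

text \<open>The bijection \<open>w\<close> carries sets of positions to sets of entries, which
  reduces the count to \<open>card_sets_around\<close>, where \<open>w\<close> no longer
  occurs.\<close>

lemma card_sets_recording_two:
  assumes w: "w permutes {1..n}" and i: "i \<in> {1..<n}"
  shows "card {A. A \<subseteq> {1..n} \<and> card A = 4 \<and> w i \<in> A \<and> w (Suc i) \<in> A \<and>
    card {p \<in> {1..i}. w p \<in> A} = 2} = (i - 1) * (n - i - 1)"
    (is "card ?R = _")
proof -
  let ?S = "{B. B \<subseteq> {1..n} \<and> card B = 4 \<and> i \<in> B \<and> Suc i \<in> B \<and> card (B \<inter> {1..i}) = 2}"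
  have inj: "inj w"
    using w by (rule permutes_inj)
  have img: "w ` B \<subseteq> {1..n} \<longleftrightarrow> B \<subseteq> {1..n}" for B
    using permutes_in_image[OF w] by blast
  have "{p \<in> {1..i}. p \<in> B} = B \<inter> {1..i}" for B
    by auto
  then have image_iff: "w ` B \<in> ?R \<longleftrightarrow> B \<in> ?S" for B
    by (simp only: mem_Collect_eq img inj_image_mem_iff[OF inj]
        card_image[OF inj_on_subset[OF inj subset_UNIV]])
  have "?R = image w ` ?S"
  proof (intro set_eqI iffI)
    fix A assume A: "A \<in> ?R"
    have "A = w ` (w -` A)"
      using permutes_surj[OF w] by (simp add: surj_image_vimage_eq)
    moreover from this have "w -` A \<in> ?S"
      using A image_iff[of "w -` A"] by simp
    ultimately show "A \<in> image w ` ?S"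
      by (rule image_eqI)
  next
    fix A assume "A \<in> image w ` ?S"
    then obtain B where "A = w ` B" "B \<in> ?S"
      by (rule imageE)
    then show "A \<in> ?R"
      by (simp only: image_iff)
  qed
  moreover have "inj_on (image w) ?S"
    by (intro inj_onI) (simp only: inj_image_eq_iff[OF inj])
  ultimately show ?thesis
    using card_sets_around[OF i] by (simp add: card_image)
qed

text \<open>Double counting: the contribution of each step is summed over all sets first. The
  starting word is arbitrary because each step of the induction changes it.\<close>

lemma sum_count_list_recorded_indices:
  assumes "w permutes {1..n}" "set \<rho> \<subseteq> {1..<n}"
  shows "(\<Sum>A | A \<subseteq> {1..n} \<and> card A = 4. count_list (recorded_indices A w \<rho>) 2) =
    (\<Sum>i\<leftarrow>\<rho>. (i - 1) * (n - i - 1))"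
  using assms
proof (induction \<rho> arbitrary: w)
  case Nil
  then show ?case by simp
next
  case (Cons i \<rho>)
  let ?F = "{A. A \<subseteq> {1..n} \<and> card A = 4}"
  let ?P = "\<lambda>A. w i \<in> A \<and> w (Suc i) \<in> A \<and> card {p \<in> {1..i}. w p \<in> A} = 2"
  have i: "i \<in> {1..<n}" and \<rho>: "set \<rho> \<subseteq> {1..<n}"
    using Cons.prems by auto
  have fin: "finite ?F"
    by (rule finite_subset[of _ "Pow {1..n}"]) auto
  have "swap_positions w i permutes {1..n}"
    unfolding swap_positions_def
    using i by (intro permutes_compose permutes_swap_id Cons.prems(1)) auto
  note IH = Cons.IH[OF this \<rho>]
  have "(\<Sum>A\<in>?F. count_list (recorded_indices A w (i # \<rho>)) 2) =
      (\<Sum>A\<in>?F. (if ?P A then 1 else 0) + count_list (recorded_indices A (swap_positions w i) \<rho>) 2)"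
    by (intro sum.cong) auto
  also have "\<dots> = card {A \<in> ?F. ?P A} + (\<Sum>i\<leftarrow>\<rho>. (i - 1) * (n - i - 1))"
    using fin IH by (simp add: sum.distrib sum.If_cases Int_def)
  also have "card {A \<in> ?F. ?P A} = (i - 1) * (n - i - 1)"
    using card_sets_recording_two[OF Cons.prems(1) i] by simp
  finally show ?case by simp
qed

section \<open>Double count for reduced decompositions of the long word\<close>

theorem proposition5p3:
  fixes n :: nat and \<rho> :: "nat list" and X :: "nat list set"
  assumes "reduced_decomposition n (long_word n) \<rho>"
    and "X = {[1,2,3,2,1,2], [3,2,1,2,3,2], [2,1,2,3,2,1], [2,3,2,1,2,3]}"
  shows "int (card (subnetworks n 4 X \<rho>)) =
    (\<Sum>j = 1..n choose 2. (int (\<rho> ! (j - 1)) - 1) * (int n - int (\<rho> ! (j - 1)) - 1))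
      - 2 * int (n choose 4)"
proof -
  let ?F = "{A. A \<subseteq> {1..n} \<and> card A = 4}"
  have set: "set \<rho> \<subseteq> {1..<n}" and len: "length \<rho> = card (inversions n (long_word n))"
    and prod: "foldl swap_positions id \<rho> = long_word n"
    using assms(1) by (auto simp: reduced_decomposition_def word_product_def)
  have fin: "finite ?F"
    by (rule finite_subset[of _ "Pow {1..n}"]) auto
  \<comment> \<open>Starting without inversions, the length condition on \<open>\<rho>\<close>
    becomes the equality that \<open>ascents_recorded_indices\<close> asks for.\<close>
  have "inversions n id = {}"
    by (auto simp: inversions_def)
  then have ascents: "ascents (restricted_word n A id) (induced_decomposition A \<rho>)
      (rev (restricted_word n A id))" for A
    using ascents_recorded_indices[OF set, of id A] len prod
    by (simp add: induced_decomposition_def restricted_word_long_word)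
  have count: "count_list (induced_decomposition A \<rho>) 2 =
      2 + (if induced_decomposition A \<rho> \<in> X then 1 else 0)" if "A \<in> ?F" for A
  proof -
    have "length (sorted_list_of_set A) = 4"
      using that by simp
    then obtain a b c d where abcd: "sorted_list_of_set A = [a, b, c, d]"
      by (auto simp: numeral_eq_Suc length_Suc_conv
          simp del: sorted_list_of_set.length_sorted_key_list_of_set)
    moreover have "a < b" "b < c" "c < d"
      using strict_sorted_list_of_set[of A] abcd by auto
    ultimately show ?thesis
      using count_list_ascents_four[of a b c d] ascents[of A] that assms(2)
      by (simp add: restricted_word_id)
  qed
  have "(\<Sum>A\<in>?F. count_list (induced_decomposition A \<rho>) 2) =
      (\<Sum>A\<in>?F. 2 + (if induced_decomposition A \<rho> \<in> X then 1 else 0))"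
    by (intro sum.cong refl count)
  also have "\<dots> = 2 * card ?F + card {A \<in> ?F. induced_decomposition A \<rho> \<in> X}"
    using fin by (simp only: sum.distrib sum.If_cases) (simp add: Int_def)
  finally have "(\<Sum>A\<in>?F. count_list (induced_decomposition A \<rho>) 2) =
      2 * card ?F + card {A \<in> ?F. induced_decomposition A \<rho> \<in> X}" .
  moreover have "card ?F = n choose 4"
    using n_subsets[of "{1..n}" 4] by simp
  moreover have "{A \<in> ?F. induced_decomposition A \<rho> \<in> X} = subnetworks n 4 X \<rho>"
    by (auto simp: subnetworks_def)
  moreover have "(\<Sum>A\<in>?F. count_list (induced_decomposition A \<rho>) 2) =
      (\<Sum>i\<leftarrow>\<rho>. (i - 1) * (n - i - 1))"
    using sum_count_list_recorded_indices[OF permutes_id set]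
    by (simp add: induced_decomposition_def)
  ultimately have "int (card (subnetworks n 4 X \<rho>)) =
      int (\<Sum>i\<leftarrow>\<rho>. (i - 1) * (n - i - 1)) - 2 * int (n choose 4)"
    by simp
  also have "int (\<Sum>i\<leftarrow>\<rho>. (i - 1) * (n - i - 1)) =
      (\<Sum>j<length \<rho>. int ((\<rho> ! j - 1) * (n - \<rho> ! j - 1)))"
    by (simp add: sum_list_sum_nth atLeast0LessThan)
  also have "\<dots> = (\<Sum>j<length \<rho>. (int (\<rho> ! j) - 1) * (int n - int (\<rho> ! j) - 1))"
  proof (rule sum.cong)
    fix j assume "j \<in> {..<length \<rho>}"
    \<comment> \<open>Within these bounds the truncated subtractions on naturals agree with those on
      integers.\<close>
    then have "\<rho> ! j \<in> {1..<n}"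
      using set nth_mem by blast
    then show "int ((\<rho> ! j - 1) * (n - \<rho> ! j - 1)) =
        (int (\<rho> ! j) - 1) * (int n - int (\<rho> ! j) - 1)"
      by simp
  qed simp
  also have "\<dots> = (\<Sum>j = 1..n choose 2.
      (int (\<rho> ! (j - 1)) - 1) * (int n - int (\<rho> ! (j - 1)) - 1))"
    \<comment> \<open>Shifts from 0-based list positions to 1-based indices; the ranges match since
      the long word inverts all \<open>n choose 2\<close> pairs.\<close>
    by (rule sum.reindex_bij_witness[of _ "\<lambda>j. j - 1" Suc])
      (auto simp: len card_inversions_long_word)
  finally show ?thesis .
qed

end
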